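(* Let $D$ be a finite set of $n\geq 3$ dots in general position in the Euclidean plane or in the round sphere, and let $k,\ell\geq 0$ be integers with $k+\ell=n-3$. Then the number of circles that pass through three of the dots and separate the remaining $n-3$ dots into subsets of size $k$ and $\ell$ (one subset on each side of the circle, where the two sides are not distinguished) is \[ \begin{cases} 2(k+1)(\ell+1) & \text{if } k\neq \ell,\\ (k+1)^2 & \text{if } k=\ell.\end{cases} \]
   Context: "Dots" are the points of a distinguished finite set $D$. A circle in the sphere is the intersection of the sphere with a plane of the ambient $\mathbb{R}^3$ meeting the sphere in more than one point (great circles included); a circle in the plane is an ordinary Euclidean circle of positive radius (lines are not circles). Dots in the sphere are in general position if no four of them lie on a circle; dots in the plane are in general position if no four of them lie on a circle and no three of them lie on a line. The two sides of a circle are the two connected components of its complement (in the plane: the inside and the outside). The circles counted are unoriented: a circle is counted if one of its sides contains exactly $k$ dots and the other exactly $\ell$ dots. *)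

theory Defs
  imports "HOL-Analysis.Analysis"
begin

text \<open>A circle is identified with its set of points, so it is automatically unoriented.
  Note that \<^term>\<open>sphere c r\<close> in the Euclidean plane is the ordinary circle with
  centre \<^term>\<open>c\<close> and radius \<^term>\<open>r\<close>.\<close>

definition plane_circles :: "(real^2) set set" where
  "plane_circles = {sphere c r | c r. r > 0}"

definition sphere_circles :: "(real^3) set \<Rightarrow> (real^3) set set" where
  "sphere_circles S =
     {S \<inter> {x. a \<bullet> x = b} | a b. a \<noteq> 0 \<and> (\<exists>x y. x \<noteq> y \<and> {x, y} \<subseteq> S \<inter> {x. a \<bullet> x = b})}"

definition no_four_cocircular :: "'a set set \<Rightarrow> 'a set \<Rightarrow> bool" where
  "no_four_cocircular \<C> D \<longleftrightarrow> \<not> (\<exists>F\<subseteq>D. card F = 4 \<and> (\<exists>C\<in>\<C>. F \<subseteq> C))"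

definition plane_general_position :: "(real^2) set \<Rightarrow> bool" where
  "plane_general_position D \<longleftrightarrow>
     no_four_cocircular plane_circles D \<and> \<not> (\<exists>T\<subseteq>D. card T = 3 \<and> collinear T)"

definition sphere_general_position :: "(real^3) set \<Rightarrow> (real^3) set \<Rightarrow> bool" where
  "sphere_general_position S D \<longleftrightarrow> no_four_cocircular (sphere_circles S) D"

text \<open>In the following definition, \<^term>\<open>X\<close> is the ambient plane or sphere and
  \<^term>\<open>T\<close> consists of three dots on the circle \<^term>\<open>C\<close>. The sides
  \<^term>\<open>U\<close> and \<^term>\<open>V\<close> can be named in either order, so the predicate is
  symmetric in \<^term>\<open>k\<close> and \<^term>\<open>l\<close>.\<close>

definition separates_dots ::
    "'a::topological_space set \<Rightarrow> 'a set \<Rightarrow> 'a set \<Rightarrow> nat \<Rightarrow> nat \<Rightarrow> bool" where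
  "separates_dots X D C k l \<longleftrightarrow>
     (\<exists>T U V. T \<subseteq> D \<and> card T = 3 \<and> T \<subseteq> C \<and>
        components (X - C) = {U, V} \<and> U \<noteq> V \<and>
        card ((D - T) \<inter> U) = k \<and> card ((D - T) \<inter> V) = l)"

end

theory Submission imports Defs begin

text \<open>Order the dots by a generic linear functional \<open>e\<close>. Each triple of dots has a unique middle
  dot \<open>b\<close>, and the circles are counted according to it (\<open>card_triples_by_middle\<close>).

  Inversion at \<open>b\<close> turns the circles through \<open>b\<close> into the lines of a plane, and the two sides of
  such a circle into the two sides of its line. The remaining dots become \<open>n - 1\<close> points, no three
  of them collinear, and a vertical line puts the dots before \<open>b\<close> on its left and those after \<open>b\<close>
  on its right. So the task is to count the pairs (left point, right point) whose line has exactly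
  \<open>j\<close> points above it.

  That number depends only on \<open>j\<close> and on how many points lie on each side of the vertical line.
  This is an exact form of the lemma of Lovasz on \<open>j\<close>-edges. When a line turns about a
  point \<open>v\<close> from vertical to vertical, the number of points above it starts at the number of points
  to the right of \<open>v\<close>, ends at the number of points to the left, and changes by one at every point
  it meets; so the excess of crossings of level \<open>j\<close> in one direction over those in the other is
  forced (\<open>rotation_balance\<close>). This excess is the number of edges of level \<open>j\<close> leaving \<open>v\<close> to the
  right minus the number arriving from the left, and summing it over all \<open>v\<close> to the left of the vertical
  line counts the edges that cross it, because an edge with both ends on the left cancels
  (\<open>crossing_edges\<close>).

  If \<open>b\<close> has \<open>h\<close> dots before it, the count is thus the sum of \<open>rotation_net (n - 1) i j\<close> over
  \<open>i < h\<close>. Since \<open>h\<close> runs once through \<open>0, \<dots>, n - 1\<close>, a summation yields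
  \<open>(j + 1) * (n - 2 - j)\<close>, which is \<open>(k + 1) * (l + 1)\<close> both for \<open>j = k\<close> and for \<open>j = l\<close>
  (\<open>sum_rotation_net\<close>). A circle separates the dots into \<open>k\<close> and \<open>l\<close> exactly if its number of
  points above is \<open>k\<close> or \<open>l\<close>. These alternatives exclude each other for \<open>k \<noteq> l\<close> and coincide
  for \<open>k = l\<close>, whence the two cases of the formula.

  Everything specific to the plane or the sphere is collected in the hypotheses of
  \<open>card_separating_by_inversion\<close>: three dots determine a circle, a circle has two sides, and
  inversion at a dot maps the other dots into a plane in which the sides are half planes.\<close>

section \<open>Rotating a line about a point\<close>

text \<open>The net number of downward passages from \<open>j + 1\<close> to \<open>j\<close> of an integer walk with unit steps that
  leads from \<open>m - 1 - i\<close> to \<open>i\<close>. In the application \<open>m\<close> counts the points including the pivot, and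
  \<open>i\<close> those to its left. The comparisons with \<open>m - 1 - i\<close> are rearranged to avoid truncated subtraction.\<close>

definition rotation_net :: "nat \<Rightarrow> nat \<Rightarrow> nat \<Rightarrow> int" where
  "rotation_net m i j = of_bool (i \<le> j \<and> i + j + 1 < m) - of_bool (m \<le> i + j + 1 \<and> j < i)"

text \<open>With \<open>R\<close> for ``to the right of the pivot'' and \<open>\<sigma>\<close> for the slope as seen from the pivot,
  this is the number of points above the line through the pivot and \<open>w\<close>: a point on the right is
  above if its slope is larger, a point on the left if its slope is smaller.\<close>

definition level :: "('a \<Rightarrow> bool) \<Rightarrow> ('a \<Rightarrow> real) \<Rightarrow> 'a set \<Rightarrow> 'a \<Rightarrow> nat" where
  "level R \<sigma> W w = card {z\<in>W. R z \<and> \<sigma> w < \<sigma> z \<or> \<not> R z \<and> \<sigma> z < \<sigma> w}"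

text \<open>Let the slope of the turning line increase. The number of points above it drops
  by one at a point on the right and grows by one at a point on the left, and in both cases the
  level of the point is the smaller of the two numbers. So the left-hand side counts the passages
  from \<open>j + 1\<close> to \<open>j\<close> minus those from \<open>j\<close> to \<open>j + 1\<close>, and it depends on the two end
  values only. Formally the point of largest slope is split off: on the right it
  raises the level of all others by one, on the left it leaves the levels alone.\<close>

lemma rotation_balance:
  fixes \<sigma> :: "'a \<Rightarrow> real" and R :: "'a \<Rightarrow> bool"
  assumes "finite W" "inj_on \<sigma> W"
  shows "int (card {w\<in>W. R w \<and> level R \<sigma> W w = j})
         - int (card {w\<in>W. \<not> R w \<and> level R \<sigma> W w = j})
       = rotation_net (card W + 1) (card {w\<in>W. \<not> R w}) j"
  using assms
proof (induction W arbitrary: j rule: finite_ranking_induct[where f = \<sigma>])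
  case empty
  show ?case by (simp add: rotation_net_def)
next
  case (insert x W)
  show ?case
  proof (cases "x \<in> W")
    case True
    then show ?thesis using insert by (simp add: insert_absorb)
  next
    case False
    have lt: "\<sigma> y < \<sigma> x" if "y \<in> W" for y
      using insert(2)[OF that] insert(4) that False by (auto simp: inj_on_def order_less_le)
    have inj: "inj_on \<sigma> W" using insert(4) by (rule inj_on_subset) auto
    note IH = insert(3)[OF inj]
    have fin: "finite W" by fact
    have cW: "card W = card {w\<in>W. R w} + card {w\<in>W. \<not> R w}"
      by (subst card_Un_disjoint[symmetric]) (auto simp: fin intro!: arg_cong[of _ _ card])
    show ?thesis
    proof (cases "R x")
      case True
      have fo: "level R \<sigma> (insert x W) w = Suc (level R \<sigma> W w)" if "w \<in> W" for w
      proof -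
        have "{z \<in> insert x W. R z \<and> \<sigma> w < \<sigma> z \<or> \<not> R z \<and> \<sigma> z < \<sigma> w} =
          insert x {z \<in> W. R z \<and> \<sigma> w < \<sigma> z \<or> \<not> R z \<and> \<sigma> z < \<sigma> w}"
          using lt[OF that] True by auto
        then show ?thesis using False fin by (simp add: level_def)
      qed
      have fx: "level R \<sigma> (insert x W) x = card {w\<in>W. \<not> R w}"
        unfolding level_def by (rule arg_cong[of _ _ card]) (use lt True in force)
      have eqR: "{w \<in> insert x W. R w \<and> level R \<sigma> (insert x W) w = j} =
        {w\<in>W. R w \<and> Suc (level R \<sigma> W w) = j} \<union> (if card {w\<in>W. \<not> R w} = j then {x} else {})"
        using fo fx True False by auto
      have eqL: "{w \<in> insert x W. \<not> R w \<and> level R \<sigma> (insert x W) w = j} = {w\<in>W. \<not> R w \<and> Suc (level R \<sigma> W w) = j}"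
        using fo True by auto
      have eqN: "{w \<in> insert x W. \<not> R w} = {w \<in> W. \<not> R w}" using True by auto
      have cR: "card {w \<in> insert x W. R w \<and> level R \<sigma> (insert x W) w = j} =
        card {w\<in>W. R w \<and> Suc (level R \<sigma> W w) = j} + of_bool (card {w\<in>W. \<not> R w} = j)"
        unfolding eqR using False fin by (subst card_Un_disjoint) auto
      show ?thesis
      proof (cases j)
        case 0
        show ?thesis unfolding cR eqL eqN using 0 cW False fin by (auto simp: rotation_net_def)
      next
        case (Suc i)
        show ?thesis unfolding cR eqL eqN using IH[of i] Suc cW False fin
          by (auto simp: rotation_net_def of_bool_def split: if_splits)
      qed
    next
      case nR: False
      have fo: "level R \<sigma> (insert x W) w = level R \<sigma> W w" if "w \<in> W" for w
        unfolding level_def by (rule arg_cong[of _ _ card]) (use lt[OF that] nR in auto)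
      have fx: "level R \<sigma> (insert x W) x = card {w\<in>W. \<not> R w}"
        unfolding level_def by (rule arg_cong[of _ _ card]) (use lt nR in force)
      have eqL: "{w \<in> insert x W. \<not> R w \<and> level R \<sigma> (insert x W) w = j} =
        {w\<in>W. \<not> R w \<and> level R \<sigma> W w = j} \<union> (if card {w\<in>W. \<not> R w} = j then {x} else {})"
        using fo fx nR False by auto
      have eqR: "{w \<in> insert x W. R w \<and> level R \<sigma> (insert x W) w = j} = {w\<in>W. R w \<and> level R \<sigma> W w = j}"
        using fo nR by auto
      have eqN: "{w \<in> insert x W. \<not> R w} = insert x {w \<in> W. \<not> R w}" using nR by auto
      have cL: "card {w \<in> insert x W. \<not> R w \<and> level R \<sigma> (insert x W) w = j} =
        card {w\<in>W. \<not> R w \<and> level R \<sigma> W w = j} + of_bool (card {w\<in>W. \<not> R w} = j)"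
        unfolding eqL using False fin by (subst card_Un_disjoint) auto
      show ?thesis unfolding cL eqR eqN using IH[of j] cW False fin
        by (auto simp: rotation_net_def of_bool_def split: if_splits)
    qed
  qed
qed

section \<open>Edges crossing a line in the plane\<close>

lemma sum_over_ranks:
  fixes x :: "'a \<Rightarrow> real" and g :: "nat \<Rightarrow> 'b::comm_monoid_add"
  assumes "finite A" "inj_on x A"
  shows "(\<Sum>v\<in>A. g (card {u\<in>A. x u < x v})) = (\<Sum>i<card A. g i)"
  using assms
proof (induction A rule: finite_ranking_induct[where f = x])
  case empty
  show ?case by simp
next
  case (insert y A)
  show ?case
  proof (cases "y \<in> A")
    case True
    then show ?thesis using insert by (simp add: insert_absorb)
  next
    case False
    have lt: "x u < x y" if "u \<in> A" for u
      using insert(2)[OF that] insert(4) that False by (auto simp: inj_on_def order_less_le)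
    have inj: "inj_on x A" using insert(4) by (rule inj_on_subset) auto
    have "{u \<in> insert y A. x u < x y} = A" using lt by auto
    moreover have "{u \<in> insert y A. x u < x v} = {u\<in>A. x u < x v}" if "v \<in> A" for v
      using lt[OF that] by auto
    ultimately show ?thesis
      using insert(3)[OF inj] False insert(1) by (simp add: add.commute)
  qed
qed

text \<open>Twice the signed area of the triangle with vertices \<open>u\<close>, \<open>w\<close>, \<open>z\<close> in the coordinates \<open>X\<close>, \<open>Y\<close>;
  for \<open>X u < X w\<close> it is positive exactly if \<open>z\<close> lies above the line through \<open>u\<close> and \<open>w\<close>.\<close>

definition det3 :: "('a \<Rightarrow> real) \<Rightarrow> ('a \<Rightarrow> real) \<Rightarrow> 'a \<Rightarrow> 'a \<Rightarrow> 'a \<Rightarrow> real" where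
  "det3 X Y u w z = (X w - X u) * (Y z - Y u) - (Y w - Y u) * (X z - X u)"

definition above :: "('a \<Rightarrow> real) \<Rightarrow> ('a \<Rightarrow> real) \<Rightarrow> 'a set \<Rightarrow> 'a \<Rightarrow> 'a \<Rightarrow> 'a set" where
  "above X Y Q u w = {z\<in>Q. z \<noteq> u \<and> z \<noteq> w \<and> det3 X Y u w z > 0}"

text \<open>For each \<open>v\<close> on the left, \<open>rotation_balance\<close> gives the number of edges of level \<open>j\<close> from \<open>v\<close> to
  the right minus the number from the left to \<open>v\<close>. In the sum over these \<open>v\<close> an edge between two
  left points is counted once with each sign, and only the edges crossing \<open>X = 0\<close> survive.
  The net contribution of \<open>v\<close> is a function of its rank, so the sum runs over ranks.\<close>

lemma crossing_edges:
  fixes X Y :: "'a \<Rightarrow> real"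
  assumes fin: "finite Q" and inj: "inj_on X Q" and nz: "\<And>u. u \<in> Q \<Longrightarrow> X u \<noteq> 0"
    and gp: "\<And>u w z. \<lbrakk>u \<in> Q; w \<in> Q; z \<in> Q; u \<noteq> w; u \<noteq> z; w \<noteq> z\<rbrakk> \<Longrightarrow> det3 X Y u w z \<noteq> 0"
  shows "int (card {(u,w). u \<in> Q \<and> w \<in> Q \<and> X u < 0 \<and> 0 < X w \<and> card (above X Y Q u w) = j})
       = (\<Sum>i < card {u\<in>Q. X u < 0}. rotation_net (card Q) i j)"
proof -
  define A where "A = {u\<in>Q. X u < 0}"
  define out where "out v = {w\<in>Q. X v < X w \<and> card (above X Y Q v w) = j}" for v
  define inc where "inc v = {u\<in>Q. X u < X v \<and> card (above X Y Q u v) = j}" for v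
  have net: "int (card (out v)) - int (card (inc v)) = rotation_net (card Q) (card {u\<in>Q. X u < X v}) j"
    if v: "v \<in> Q" for v
  proof -
    define W where "W = Q - {v}"
    define \<sigma> where "\<sigma> z = (Y z - Y v) / (X z - X v)" for z
    define R where "R z \<longleftrightarrow> X v < X z" for z
    have ne: "X z \<noteq> X v" if "z \<in> W" for z
      using that inj v by (auto simp: W_def inj_on_def)
    have slope: "Y z - Y v = \<sigma> z * (X z - X v)" if "z \<in> W" for z
      using ne[OF that] by (simp add: \<sigma>_def)
    \<comment> \<open>Both orders of the pivot and \<open>w\<close> lead to the same sign condition on slopes, so that one notion of level serves the edges on either side of the pivot.\<close>
    have d1: "det3 X Y v w z = (X w - X v) * ((X z - X v) * (\<sigma> z - \<sigma> w))"
      if "z \<in> W" "w \<in> W" for w z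
      unfolding det3_def slope[OF that(1)] slope[OF that(2)] by (simp add: algebra_simps)
    have d2: "det3 X Y w v z = (X v - X w) * ((X z - X v) * (\<sigma> z - \<sigma> w))"
      if "z \<in> W" "w \<in> W" for w z
    proof -
      have "det3 X Y w v z = - det3 X Y v w z" by (simp add: det3_def algebra_simps)
      then show ?thesis using d1[OF that] by (simp add: algebra_simps)
    qed
    have injs: "inj_on \<sigma> W"
    proof (rule inj_onI, rule ccontr)
      fix w z assume "w \<in> W" "z \<in> W" "\<sigma> w = \<sigma> z" "w \<noteq> z"
      then show False using d1[of z w] gp[of v w z] v by (auto simp: W_def)
    qed
    have pos: "((X z - X v) * (\<sigma> z - \<sigma> w) > 0) \<longleftrightarrow> (R z \<and> \<sigma> w < \<sigma> z \<or> \<not> R z \<and> \<sigma> z < \<sigma> w)"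
      if "z \<in> W" for z w
      using ne[OF that] by (auto simp: R_def zero_less_mult_iff)
    have ab1: "above X Y Q v w = {z\<in>W. R z \<and> \<sigma> w < \<sigma> z \<or> \<not> R z \<and> \<sigma> z < \<sigma> w}" (is "_ = ?F w")
      if w: "w \<in> W" "X v < X w" for w
    proof -
      have "above X Y Q v w = {z\<in>W. z \<noteq> w \<and> (X z - X v) * (\<sigma> z - \<sigma> w) > 0}"
        unfolding above_def using d1[OF _ w(1)] w by (auto simp: W_def zero_less_mult_iff)
      also have "\<dots> = ?F w" using pos by auto
      finally show ?thesis .
    qed
    have ab2: "above X Y Q w v = {z\<in>W. R z \<and> \<sigma> w < \<sigma> z \<or> \<not> R z \<and> \<sigma> z < \<sigma> w}" (is "_ = ?F w")
      if w: "w \<in> W" "X w < X v" for w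
    proof -
      have "above X Y Q w v = {z\<in>W. z \<noteq> w \<and> (X z - X v) * (\<sigma> z - \<sigma> w) > 0}"
        unfolding above_def using d2[OF _ w(1)] w by (auto simp: W_def zero_less_mult_iff)
      also have "\<dots> = ?F w" using pos by auto
      finally show ?thesis .
    qed
    have o: "out v = {w\<in>W. R w \<and> card (?F w) = j}"
    proof -
      have "out v = {w\<in>W. R w \<and> card (above X Y Q v w) = j}"
        by (auto simp: out_def W_def R_def)
      also have "\<dots> = {w\<in>W. R w \<and> card (?F w) = j}"
        by (rule Collect_cong) (use ab1 R_def in \<open>auto cong: conj_cong\<close>)
      finally show ?thesis .
    qed
    have i: "inc v = {w\<in>W. \<not> R w \<and> card (?F w) = j}"
    proof -
      have lt: "\<not> R w \<longleftrightarrow> X w < X v" if "w \<in> W" for w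
        using ne[OF that] by (auto simp: R_def)
      have "inc v = {w\<in>W. X w < X v \<and> card (above X Y Q w v) = j}"
        by (auto simp: inc_def W_def)
      also have "\<dots> = {w\<in>W. \<not> R w \<and> card (?F w) = j}"
        by (rule Collect_cong) (use ab2 lt in \<open>auto cong: conj_cong\<close>)
      finally show ?thesis .
    qed
    have c: "{w\<in>W. \<not> R w} = {u\<in>Q. X u < X v}"
      using ne by (force simp: W_def R_def)
    have cQ: "card W + 1 = card Q"
      using v fin by (simp add: W_def card_gt_0_iff) (metis Suc_pred card_gt_0_iff empty_iff)
    show ?thesis
      using rotation_balance[of W \<sigma> R j] injs fin unfolding o i c cQ level_def by (simp add: W_def)
  qed
  have finA: "finite A" using fin by (simp add: A_def)
  let ?in = "{(u,w). u \<in> A \<and> w \<in> A \<and> X u < X w \<and> card (above X Y Q u w) = j}"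
  let ?cross = "{(u,w). u \<in> Q \<and> w \<in> Q \<and> X u < 0 \<and> 0 < X w \<and> card (above X Y Q u w) = j}"
  have fin2: "finite ?in" "finite ?cross"
    using fin by (auto intro: finite_subset[of _ "Q \<times> Q"] simp: A_def)
  have "(\<Sum>v\<in>A. card (out v)) = card (SIGMA v:A. out v)"
    using finA fin by (simp add: out_def)
  also have "(SIGMA v:A. out v) = ?in \<union> ?cross"
    using nz by (force simp: A_def out_def not_less_iff_gr_or_eq)
  also have "card \<dots> = card ?in + card ?cross"
    using fin2 by (subst card_Un_disjoint) (auto simp: A_def)
  finally have so: "(\<Sum>v\<in>A. card (out v)) = card ?in + card ?cross" .
  have "(\<Sum>v\<in>A. card (inc v)) = card (SIGMA v:A. inc v)"
    using finA fin by (simp add: inc_def)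
  also have "\<dots> = card (prod.swap ` (SIGMA v:A. inc v))"
    by (simp add: card_image)
  also have "prod.swap ` (SIGMA v:A. inc v) = ?in"
    by (force simp: A_def inc_def image_iff)
  finally have si: "(\<Sum>v\<in>A. card (inc v)) = card ?in" .
  have "int (card ?cross) = (\<Sum>v\<in>A. int (card (out v)) - int (card (inc v)))"
    using so si by (simp add: sum_subtractf flip: of_nat_sum)
  also have "\<dots> = (\<Sum>v\<in>A. rotation_net (card Q) (card {u\<in>A. X u < X v}) j)"
  proof (rule sum.cong[OF refl])
    fix v assume v: "v \<in> A"
    then have "{u\<in>Q. X u < X v} = {u\<in>A. X u < X v}" by (auto simp: A_def)
    then show "int (card (out v)) - int (card (inc v)) = rotation_net (card Q) (card {u\<in>A. X u < X v}) j"
      using net[of v] v by (simp add: A_def)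
  qed
  also have "\<dots> = (\<Sum>i<card A. rotation_net (card Q) i j)"
    using finA inj by (intro sum_over_ranks) (auto simp: A_def inj_on_def)
  finally show ?thesis by (simp add: A_def)
qed

lemma sum_sum_lessThan:
  fixes f :: "nat \<Rightarrow> int"
  shows "(\<Sum>h<Suc m. \<Sum>i<h. f i) = (\<Sum>i<m. int (m - i) * f i)"
proof (induction m)
  case 0
  show ?case by simp
next
  case (Suc m)
  have "(\<Sum>i<m. int (Suc m - i) * f i) = (\<Sum>i<m. int (m - i) * f i + f i)"
    by (intro sum.cong) (auto simp: Suc_diff_le algebra_simps)
  then show ?case using Suc by (simp add: sum.distrib)
qed

text \<open>The summand \<open>rotation_net m i k\<close> occurs in the double sum once for each \<open>h > i\<close>. With
  \<open>t = min (k + 1) (l + 1)\<close> it is \<open>1\<close> for the first \<open>t\<close> values of \<open>i\<close>, \<open>-1\<close> for the last \<open>t\<close>, and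
  zero in between. Reflecting the last range onto the first leaves an
  arithmetic progression with sum \<open>t * (m - t)\<close>, and \<open>{t, m - t} = {k + 1, l + 1}\<close>.\<close>

lemma sum_rotation_net:
  "(\<Sum>h<k+l+3. \<Sum>i<h. rotation_net (k+l+2) i k) = int ((k+1) * (l+1))"
proof -
  define t m where "t = min (k+1) (l+1)" and "m = k+l+2"
  have tm: "t \<le> m" by (auto simp: t_def m_def)
  have net: "rotation_net m i k = of_bool (i < t) - of_bool (m - Suc i < t)" if "i < m" for i
    using that by (auto simp: rotation_net_def t_def m_def of_bool_def)
  have "(\<Sum>h<k+l+3. \<Sum>i<h. rotation_net m i k) = (\<Sum>i<m. int (m - i) * rotation_net m i k)"
    using sum_sum_lessThan[of "\<lambda>i. rotation_net m i k" m] by (simp add: m_def numeral_3_eq_3)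
  also have "\<dots> = (\<Sum>i<m. int (m - i) * of_bool (i < t)) - (\<Sum>i<m. int (m - i) * of_bool (m - Suc i < t))"
    unfolding sum_subtractf[symmetric]
    by (intro sum.cong refl) (simp add: net right_diff_distrib del: of_bool_eq_iff)
  also have "(\<Sum>i<m. int (m - i) * of_bool (m - Suc i < t)) = (\<Sum>i<m. int (Suc i) * of_bool (i < t))"
    by (subst sum.nat_diff_reindex[symmetric]) (intro sum.cong refl, auto simp: Suc_diff_Suc)
  also have "(\<Sum>i<m. int (m - i) * of_bool (i < t)) - (\<Sum>i<m. int (Suc i) * of_bool (i < t))
      = (\<Sum>i<m. if i \<in> {..<t} then int m - 1 - 2 * int i else 0)"
    unfolding sum_subtractf[symmetric]
    by (intro sum.cong refl) (auto simp: of_nat_diff)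
  also have "\<dots> = (\<Sum>i<t. int m - 1 - 2 * int i)"
    using tm by (subst sum.inter_restrict[symmetric]) (auto intro!: sum.cong)
  also have "\<dots> = int t * (int m - int t)"
    by (induction t) (simp_all add: algebra_simps)
  also have "\<dots> = int ((k+1) * (l+1))"
    by (auto simp: t_def m_def min_def algebra_simps)
  finally show ?thesis by (simp add: m_def)
qed

section \<open>Counting circles by their middle dot\<close>

lemma card_triples_by_middle:
  fixes \<phi> :: "'a \<Rightarrow> real"
  assumes "finite D" "inj_on \<phi> D"
  shows "card {T. T \<subseteq> D \<and> card T = 3 \<and> Q T} =
    (\<Sum>b\<in>D. card {(u,w). u \<in> D \<and> w \<in> D \<and> \<phi> u < \<phi> b \<and> \<phi> b < \<phi> w \<and> Q {b,u,w}})"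
proof -
  let ?E = "\<lambda>b. {(u,w). u \<in> D \<and> w \<in> D \<and> \<phi> u < \<phi> b \<and> \<phi> b < \<phi> w \<and> Q {b,u,w}}"
  let ?g = "\<lambda>(b,u,w). {b,u,w}"
  have fin: "finite (?E b)" for b
    using assms(1) by (auto intro: finite_subset[of _ "D \<times> D"])
  have inj: "inj_on ?g (SIGMA b:D. ?E b)"
  proof (rule inj_onI)
    fix s s' assume s: "s \<in> (SIGMA b:D. ?E b)" "s' \<in> (SIGMA b:D. ?E b)" "?g s = ?g s'"
    obtain b u w b' u' w' where ss: "s = (b,u,w)" "s' = (b',u',w')"
      by (cases s, cases s') auto
    have lt: "\<phi> u < \<phi> b" "\<phi> b < \<phi> w" "\<phi> u' < \<phi> b'" "\<phi> b' < \<phi> w'"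
      and eq: "{b,u,w} = {b',u',w'}"
      using s by (auto simp: ss)
    have mem: "b' = b \<or> b' = u \<or> b' = w" "u' = b \<or> u' = u \<or> u' = w" "w' = b \<or> w' = u \<or> w' = w"
      using eq by blast+
    show "s = s'"
      unfolding ss using mem lt by (elim disjE) auto
  qed
  have img: "?g ` (SIGMA b:D. ?E b) = {T. T \<subseteq> D \<and> card T = 3 \<and> Q T}"
  proof (intro equalityI subsetI)
    fix T assume "T \<in> ?g ` (SIGMA b:D. ?E b)"
    then obtain b u w where "T = {b,u,w}" "b \<in> D" "u \<in> D" "w \<in> D" "\<phi> u < \<phi> b" "\<phi> b < \<phi> w" "Q {b,u,w}"
      by auto
    then show "T \<in> {T. T \<subseteq> D \<and> card T = 3 \<and> Q T}" by (auto simp: card_insert_if)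
  next
    fix T assume T: "T \<in> {T. T \<subseteq> D \<and> card T = 3 \<and> Q T}"
    then obtain x y z where xyz: "T = {x,y,z}" "x \<noteq> y" "x \<noteq> z" "y \<noteq> z"
      by (auto simp: card_3_iff)
    have memI: "T \<in> ?g ` (SIGMA b:D. ?E b)" if "T = {b,u,w}" "\<phi> u < \<phi> b" "\<phi> b < \<phi> w" for b u w
      using that T by (intro image_eqI[where x = "(b,u,w)"]) auto
    have "\<phi> x \<noteq> \<phi> y" "\<phi> x \<noteq> \<phi> z" "\<phi> y \<noteq> \<phi> z"
      using xyz T assms(2) by (auto simp: inj_on_def)
    then consider "\<phi> x < \<phi> y" "\<phi> y < \<phi> z" | "\<phi> x < \<phi> z" "\<phi> z < \<phi> y" | "\<phi> y < \<phi> x" "\<phi> x < \<phi> z"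
      | "\<phi> y < \<phi> z" "\<phi> z < \<phi> x" | "\<phi> z < \<phi> x" "\<phi> x < \<phi> y" | "\<phi> z < \<phi> y" "\<phi> y < \<phi> x"
      by linarith
    then show "T \<in> ?g ` (SIGMA b:D. ?E b)"
      by cases (rule memI[rotated], assumption, assumption, use xyz(1) in blast)+
  qed
  have "card {T. T \<subseteq> D \<and> card T = 3 \<and> Q T} = card (SIGMA b:D. ?E b)"
    unfolding img[symmetric] by (rule card_image[OF inj])
  then show ?thesis using assms(1) fin by (simp add: card_SigmaI)
qed

text \<open>The combinatorial form of the theorem. The functions \<open>X b\<close> and \<open>Y b\<close> are plane coordinates for
  the dots other than \<open>b\<close> in which the circles through \<open>b\<close> become lines; the sign
  of \<open>X b\<close> records the order of a dot relative to \<open>b\<close>. Which side of a circle is the upper side of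
  its line may change with the middle dot: the condition of separating \<open>k\<close> from \<open>l\<close> dots is
  symmetric in the two sides, so the orientations for different \<open>b\<close> need not match.\<close>

lemma card_separating_family:
  fixes D M :: "'a::topological_space set" and X Y :: "'a \<Rightarrow> 'a \<Rightarrow> real"
  assumes fin: "finite D" and n: "card D = k + l + 3" and DM: "D \<subseteq> M"
    and circle: "\<And>T. T \<subseteq> D \<Longrightarrow> card T = 3 \<Longrightarrow> \<exists>!C. C \<in> \<C> \<and> T \<subseteq> C"
    and no4: "no_four_cocircular \<C> D"
    and phi: "inj_on \<phi> D"
    and sgn: "\<And>b x. b \<in> D \<Longrightarrow> x \<in> D \<Longrightarrow> x \<noteq> b \<Longrightarrow> sgn (X b x) = sgn (\<phi> x - \<phi> b)"
    and inj: "\<And>b. b \<in> D \<Longrightarrow> inj_on (X b) (D - {b})"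
    and sides: "\<And>C b u w. \<lbrakk>C \<in> \<C>; {b,u,w} \<subseteq> C \<inter> D; b \<noteq> u; b \<noteq> w; u \<noteq> w\<rbrakk> \<Longrightarrow>
      \<exists>U V \<alpha> \<beta> \<delta>. components (M - C) = {U, V} \<and> U \<noteq> V \<and>
        \<alpha> * X b u + \<beta> * Y b u + \<delta> = 0 \<and> \<alpha> * X b w + \<beta> * Y b w + \<delta> = 0 \<and>
        (\<forall>z\<in>D - {b}. (z \<in> U \<longleftrightarrow> \<alpha> * X b z + \<beta> * Y b z + \<delta> > 0) \<and>
                     (z \<in> V \<longleftrightarrow> \<alpha> * X b z + \<beta> * Y b z + \<delta> < 0))"
  shows "card {C\<in>\<C>. separates_dots M D C k l} =
    (if k \<noteq> l then 2 * (k + 1) * (l + 1) else (k + 1)^2)"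
proof -
  define circ where "circ T = (THE C. C \<in> \<C> \<and> T \<subseteq> C)" for T
  have circ: "circ T \<in> \<C> \<and> T \<subseteq> circ T" if "T \<subseteq> D" "card T = 3" for T
    unfolding circ_def by (rule theI') (rule circle[OF that])
  have circ_eq: "circ T = C" if "T \<subseteq> D" "card T = 3" "C \<in> \<C>" "T \<subseteq> C" for T C
    using circle[OF that(1,2)] circ[OF that(1,2)] that by blast
  have three: "T' = T" if "T \<subseteq> D" "T' \<subseteq> D" "card T = 3" "card T' = 3" "C \<in> \<C>" "T \<subseteq> C" "T' \<subseteq> C" for T T' C
  proof (rule ccontr)
    assume ne: "T' \<noteq> T"
    have fT: "finite T" "finite T'" using that by (auto intro!: finite_subset[OF _ fin])
    have "\<not> T' \<subseteq> T" using ne fT that by (metis card_subset_eq)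
    then obtain x where x: "x \<in> T'" "x \<notin> T" by auto
    have "insert x T \<subseteq> D \<and> card (insert x T) = 4 \<and> insert x T \<subseteq> C"
      using x fT that by auto
    then show False using no4 \<open>C \<in> \<C>\<close> unfolding no_four_cocircular_def by blast
  qed
  have off: "z \<notin> C" if C: "C \<in> \<C>" "T \<subseteq> C" and T: "T \<subseteq> D" "card T = 3" and z: "z \<in> D - T" for C T z
  proof
    assume zC: "z \<in> C"
    have "finite T" using T(1) fin by (rule finite_subset)
    then have "card (insert z T) = 4" using T(2) z by simp
    moreover have "insert z T \<subseteq> D" "insert z T \<subseteq> C" using C T z zC by simp_all
    ultimately show False using no4 C(1) unfolding no_four_cocircular_def by metis
  qed
  \<comment> \<open>Circles through three dots correspond to triples, since no circle contains a fourth dot.\<close>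
  define T3 where "T3 = {T. T \<subseteq> D \<and> card T = 3 \<and> separates_dots M D (circ T) k l}"
  have "bij_betw circ T3 {C\<in>\<C>. separates_dots M D C k l}"
  proof (rule bij_betwI')
    fix T T' assume "T \<in> T3" "T' \<in> T3"
    then have T: "T \<subseteq> D" "card T = 3" "T' \<subseteq> D" "card T' = 3" by (auto simp: T3_def)
    have "T' = T" if "circ T = circ T'"
      using three[OF T(1,3,2,4), of "circ T"] circ[OF T(1,2)] circ[OF T(3,4)] that by metis
    then show "circ T = circ T' \<longleftrightarrow> T = T'" by blast
  next
    fix T assume "T \<in> T3"
    then show "circ T \<in> {C\<in>\<C>. separates_dots M D C k l}"
      using circ[of T] unfolding T3_def by simp
  next
    fix C assume C: "C \<in> {C\<in>\<C>. separates_dots M D C k l}"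
    then have CC: "C \<in> \<C>" "separates_dots M D C k l" by simp_all
    from CC(2) obtain T where T: "T \<subseteq> D" "card T = 3" "T \<subseteq> C"
      unfolding separates_dots_def by metis
    then have "circ T = C" using CC circ_eq[of T C] by simp
    then show "\<exists>T\<in>T3. C = circ T" using T C unfolding T3_def by (intro bexI[of _ T]) simp_all
  qed
  then have card1: "card {C\<in>\<C>. separates_dots M D C k l} = card T3"
    by (metis bij_betw_same_card)

  define Q where "Q b = D - {b}" for b
  have line: "\<exists>U V \<beta>. components (M - circ {b,u,w}) = {U,V} \<and> U \<noteq> V \<and>
      (\<forall>z\<in>D - {b,u,w}. \<beta> * det3 (X b) (Y b) u w z \<noteq> 0 \<and>
        (z \<in> U \<longleftrightarrow> \<beta> * det3 (X b) (Y b) u w z > 0) \<and> (z \<in> V \<longleftrightarrow> \<beta> * det3 (X b) (Y b) u w z < 0))"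
    if b: "b \<in> D" "u \<in> Q b" "w \<in> Q b" "u \<noteq> w" for b u w
  proof -
    let ?T = "{b,u,w}"
    have T: "?T \<subseteq> D" "card ?T = 3" using b by (auto simp: Q_def)
    note c = circ[OF T]
    have sub: "?T \<subseteq> circ ?T \<inter> D" and ne3: "b \<noteq> u" "b \<noteq> w"
      using c T(1) b by (auto simp: Q_def)
    from sides[OF conjunct1[OF c] sub ne3 b(4)]
    obtain U V \<alpha> \<beta> \<delta> where comp: "components (M - circ ?T) = {U, V}" "U \<noteq> V"
      and u0: "\<alpha> * X b u + \<beta> * Y b u + \<delta> = 0" and w0: "\<alpha> * X b w + \<beta> * Y b w + \<delta> = 0"
      and UV: "\<forall>z\<in>D - {b}. (z \<in> U \<longleftrightarrow> \<alpha> * X b z + \<beta> * Y b z + \<delta> > 0) \<and>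
                     (z \<in> V \<longleftrightarrow> \<alpha> * X b z + \<beta> * Y b z + \<delta> < 0)"
      by metis
    have ne: "X b w - X b u \<noteq> 0" using inj[OF b(1)] b by (auto simp: Q_def inj_on_def)
    \<comment> \<open>An affine function that vanishes at two points is a multiple of \<open>det3\<close>; multiplying by the positive number \<open>(X b w - X b u)\<^sup>2\<close> makes the factor polynomial.\<close>
    have scale: "((X b w - X b u) * \<beta>) * det3 (X b) (Y b) u w z =
        (X b w - X b u)\<^sup>2 * (\<alpha> * X b z + \<beta> * Y b z + \<delta>)" for z
      using u0 w0 unfolding det3_def by algebra
    show ?thesis
    proof (intro exI conjI ballI)
      fix z assume z: "z \<in> D - ?T"
      have "z \<notin> circ ?T" using off[of "circ ?T" ?T z] c T z by blast
      then have "z \<in> \<Union> (components (M - circ ?T))" using z DM by auto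
      then have "z \<in> U \<or> z \<in> V" unfolding comp by auto
      then have "\<alpha> * X b z + \<beta> * Y b z + \<delta> \<noteq> 0" using UV z by force
      then show "((X b w - X b u) * \<beta>) * det3 (X b) (Y b) u w z \<noteq> 0"
        unfolding scale using ne by simp
      show "z \<in> U \<longleftrightarrow> ((X b w - X b u) * \<beta>) * det3 (X b) (Y b) u w z > 0"
        unfolding scale using UV z ne by (simp add: zero_less_mult_iff)
      show "z \<in> V \<longleftrightarrow> ((X b w - X b u) * \<beta>) * det3 (X b) (Y b) u w z < 0"
        unfolding scale using UV z ne by (simp add: mult_less_0_iff)
    qed (use comp in auto)
  qed
  have det: "det3 (X b) (Y b) u w z \<noteq> 0"
    if "b \<in> D" "u \<in> Q b" "w \<in> Q b" "z \<in> Q b" "u \<noteq> w" "u \<noteq> z" "w \<noteq> z" for b u w z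
    using line[of b u w] that by (fastforce simp: Q_def)
  have sep: "separates_dots M D (circ {b,u,w}) k l \<longleftrightarrow>
      card (above (X b) (Y b) (Q b) u w) = k \<or> card (above (X b) (Y b) (Q b) u w) = l"
    if b: "b \<in> D" "u \<in> Q b" "w \<in> Q b" "u \<noteq> w" for b u w
  proof -
    let ?T = "{b,u,w}"
    let ?A = "above (X b) (Y b) (Q b) u w"
    have T: "?T \<subseteq> D" "card ?T = 3" using b by (auto simp: Q_def)
    note c = circ[OF T]
    obtain U V \<beta> where comp: "components (M - circ ?T) = {U, V}" "U \<noteq> V"
      and UV: "\<forall>z\<in>D - {b,u,w}. \<beta> * det3 (X b) (Y b) u w z \<noteq> 0 \<and>
        (z \<in> U \<longleftrightarrow> \<beta> * det3 (X b) (Y b) u w z > 0) \<and> (z \<in> V \<longleftrightarrow> \<beta> * det3 (X b) (Y b) u w z < 0)"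
      using line[OF b] by metis
    have A: "?A = {z\<in>D - ?T. det3 (X b) (Y b) u w z > 0}" by (auto simp: above_def Q_def)
    have card_rest: "card (D - ?T) = k + l" using T n fin by (simp add: card_Diff_subset)
    have AD: "?A \<subseteq> D - ?T" by (auto simp: A)
    have finD: "finite (D - ?T)" using fin by simp
    have rest: "card (D - ?T - ?A) = k + l - card ?A" "card ?A \<le> k + l"
      using card_Diff_subset[OF finite_subset[OF AD finD] AD] card_mono[OF finD AD]
      unfolding card_rest by simp_all
    \<comment> \<open>For \<open>\<beta> = 0\<close> there are no dots besides the three, and the second alternative holds trivially.\<close>
    have UVA: "(D - ?T) \<inter> U = ?A \<and> (D - ?T) \<inter> V = D - ?T - ?A \<or>
               (D - ?T) \<inter> V = ?A \<and> (D - ?T) \<inter> U = D - ?T - ?A"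
    proof (cases "\<beta> > 0")
      case True
      have "(z \<in> U \<longleftrightarrow> z \<in> ?A) \<and> (z \<in> V \<longleftrightarrow> z \<notin> ?A)" if z: "z \<in> D - ?T" for z
      proof -
        have "z \<in> ?A \<longleftrightarrow> det3 (X b) (Y b) u w z > 0" using z unfolding A by blast
        then show ?thesis using bspec[OF UV z] True
          by (simp add: zero_less_mult_iff mult_less_0_iff) linarith
      qed
      then show ?thesis using AD by blast
    next
      case False
      have "(z \<in> V \<longleftrightarrow> z \<in> ?A) \<and> (z \<in> U \<longleftrightarrow> z \<notin> ?A)" if z: "z \<in> D - ?T" for z
      proof -
        have "z \<in> ?A \<longleftrightarrow> det3 (X b) (Y b) u w z > 0" using z unfolding A by blast
        then show ?thesis using bspec[OF UV z] False
          by (simp add: zero_less_mult_iff mult_less_0_iff) linarith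
      qed
      then show ?thesis using AD by blast
    qed
    have "separates_dots M D (circ ?T) k l \<longleftrightarrow>
       (\<exists>U V. components (M - circ ?T) = {U, V} \<and> U \<noteq> V \<and>
          card ((D - ?T) \<inter> U) = k \<and> card ((D - ?T) \<inter> V) = l)"
      unfolding separates_dots_def using three[of ?T _ "circ ?T"] T c by metis
    also have "\<dots> \<longleftrightarrow> card ((D - ?T) \<inter> U) = k \<and> card ((D - ?T) \<inter> V) = l \<or>
                    card ((D - ?T) \<inter> V) = k \<and> card ((D - ?T) \<inter> U) = l"
      using comp by (auto simp: doubleton_eq_iff)
    also have "\<dots> \<longleftrightarrow> card ?A = k \<or> card ?A = l"
    proof -
      have "a = k \<and> b = l \<or> b = k \<and> a = l \<longleftrightarrow> p = k \<or> p = l"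
        if "a = p \<and> b = k + l - p \<or> b = p \<and> a = k + l - p" "p \<le> k + l" for a b p :: nat
        using that by arith
      from this[OF _ rest(2)] show ?thesis using UVA rest(1) by metis
    qed
    finally show ?thesis .
  qed

  define crossing where "crossing b j =
    {(u,w). u \<in> Q b \<and> w \<in> Q b \<and> X b u < 0 \<and> 0 < X b w \<and> card (above (X b) (Y b) (Q b) u w) = j}" for b j
  have fin_crossing: "finite (crossing b j)" for b j
    using fin by (auto intro: finite_subset[of _ "D \<times> D"] simp: crossing_def Q_def)
  have sign: "(X b x < 0 \<longleftrightarrow> \<phi> x < \<phi> b) \<and> (0 < X b x \<longleftrightarrow> \<phi> b < \<phi> x) \<and> X b x \<noteq> 0"
    if "b \<in> D" "x \<in> Q b" for b x
  proof -
    have "\<phi> x \<noteq> \<phi> b" using phi that by (auto simp: inj_on_def Q_def)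
    then show ?thesis using sgn[of b x] that
      by (auto simp: Q_def sgn_if split: if_splits)
  qed
  have total: "(\<Sum>b\<in>D. card (crossing b p)) = (p+1) * (q+1)" if pq: "p + q = k + l" for p q
  proof -
    have "int (card (crossing b p)) = (\<Sum>i<card {u\<in>D. \<phi> u < \<phi> b}. rotation_net (p+q+2) i p)"
      if b: "b \<in> D" for b
    proof -
      have c: "card (Q b) = p + q + 2" using b n fin pq by (simp add: Q_def)
      have "{u \<in> Q b. X b u < 0} = {u\<in>D. \<phi> u < \<phi> b}"
        using sign[OF b] by (auto simp: Q_def)
      then show ?thesis
        using crossing_edges[of "Q b" "X b" "Y b" p] fin inj[OF b] sign[OF b] det[OF b]
        unfolding crossing_def c[symmetric] by (simp add: Q_def)
    qed
    then have "int (\<Sum>b\<in>D. card (crossing b p)) =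
        (\<Sum>b\<in>D. \<Sum>i<card {u\<in>D. \<phi> u < \<phi> b}. rotation_net (p+q+2) i p)"
      by (simp add: of_nat_sum)
    also have "\<dots> = (\<Sum>h<card D. \<Sum>i<h. rotation_net (p+q+2) i p)"
      by (rule sum_over_ranks[OF fin phi])
    also have "\<dots> = int ((p+1) * (q+1))"
      using sum_rotation_net[where k = p and l = q] n pq by simp
    finally show ?thesis by (simp only: of_nat_eq_iff)
  qed
  have "card T3 = (\<Sum>b\<in>D. card {(u,w). u \<in> D \<and> w \<in> D \<and> \<phi> u < \<phi> b \<and> \<phi> b < \<phi> w \<and>
      separates_dots M D (circ {b,u,w}) k l})"
    unfolding T3_def by (rule card_triples_by_middle[OF fin phi])
  also have "\<dots> = (\<Sum>b\<in>D. card (crossing b k \<union> crossing b l))"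
  proof (intro sum.cong refl arg_cong[of _ _ card])
    fix b assume b: "b \<in> D"
    have "(u \<in> D \<and> w \<in> D \<and> \<phi> u < \<phi> b \<and> \<phi> b < \<phi> w \<and> separates_dots M D (circ {b,u,w}) k l) \<longleftrightarrow>
      (u,w) \<in> crossing b k \<union> crossing b l" for u w
    proof (cases "u \<in> Q b \<and> w \<in> Q b \<and> \<phi> u < \<phi> b \<and> \<phi> b < \<phi> w")
      case True
      then have "u \<noteq> w" by auto
      then show ?thesis using True sep[OF b, of u w] sign[OF b, of u] sign[OF b, of w]
        by (auto simp: crossing_def Q_def)
    next
      case False
      then show ?thesis using sign[OF b, of u] sign[OF b, of w]
        by (auto simp: crossing_def Q_def)
    qed
    then show "{(u,w). u \<in> D \<and> w \<in> D \<and> \<phi> u < \<phi> b \<and> \<phi> b < \<phi> w \<and>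
      separates_dots M D (circ {b,u,w}) k l} = crossing b k \<union> crossing b l"
      by auto
  qed
  also have "\<dots> = (if k \<noteq> l then 2 * (k + 1) * (l + 1) else (k + 1)^2)"
  proof (cases "k = l")
    case True
    then show ?thesis using total[of k l] by (simp add: power2_eq_square)
  next
    case False
    then have "crossing b k \<inter> crossing b l = {}" for b by (auto simp: crossing_def)
    then have "(\<Sum>b\<in>D. card (crossing b k \<union> crossing b l)) =
      (\<Sum>b\<in>D. card (crossing b k)) + (\<Sum>b\<in>D. card (crossing b l))"
      by (simp add: card_Un_disjoint fin_crossing sum.distrib)
    then show ?thesis using total[of k l] total[of l k] False by (simp add: algebra_simps)
  qed
  finally show ?thesis using card1 by simp
qed

section \<open>Inversion at a dot\<close>

text \<open>Inversion in the unit sphere about \<open>b\<close>, followed by the translation that moves \<open>b\<close> to the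
  origin.\<close>

definition inversion :: "'a::real_inner \<Rightarrow> 'a \<Rightarrow> 'a" where
  "inversion b x = (1 / (norm (x - b))\<^sup>2) *\<^sub>R (x - b)"

lemma inner_inversion: "a \<bullet> inversion b x = (a \<bullet> (x - b)) / (norm (x - b))\<^sup>2"
  by (simp add: inversion_def)

lemma inversion_inj: "inj_on (inversion b) (- {b})"
proof (rule inj_onI)
  fix x y assume x: "x \<in> - {b}" and y: "y \<in> - {b}" and eq: "inversion b x = inversion b y"
  have norm: "norm (inversion b z) = 1 / norm (z - b)" if "z \<noteq> b" for z :: 'a
    using that by (simp add: inversion_def power2_eq_square)
  have "1 / norm (x - b) = 1 / norm (y - b)" using norm[of x] norm[of y] x y eq by simp
  then have "norm (x - b) = norm (y - b)" using x y by simp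
  then show "x = y" using eq x y by (simp add: inversion_def)
qed

text \<open>The directions excluded by a single vector form a hyperplane, and finitely many hyperplanes have
  measure zero.\<close>

lemma generic_direction:
  fixes V :: "'a::euclidean_space set"
  assumes "finite V" "0 \<notin> V"
  shows "\<exists>e. \<forall>v\<in>V. e \<bullet> v \<noteq> 0"
proof -
  have "negligible (\<Union>v\<in>V. {x. v \<bullet> x = 0})"
    using assms by (intro negligible_Union) (auto intro!: negligible_hyperplane)
  then have "(\<Union>v\<in>V. {x. v \<bullet> x = 0}) \<noteq> UNIV" using non_negligible_UNIV by metis
  then show ?thesis by (auto simp: inner_commute)
qed

lemma generic_inversion_direction:
  fixes D :: "'a::euclidean_space set"
  assumes "finite D"
  shows "\<exists>e. inj_on (\<lambda>x. e \<bullet> x) D \<and> (\<forall>b\<in>D. inj_on (\<lambda>x. e \<bullet> inversion b x) (D - {b}))"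
proof -
  define V where "V = (\<lambda>(x,y). x - y) ` (D \<times> D) \<union>
    (\<lambda>(b,x,y). inversion b x - inversion b y) ` (D \<times> D \<times> D) - {0}"
  have "finite V" "0 \<notin> V" using assms by (auto simp: V_def)
  then obtain e where e: "\<forall>v\<in>V. e \<bullet> v \<noteq> 0" using generic_direction by blast
  have "inj_on (\<lambda>x. e \<bullet> x) D"
  proof (rule inj_onI, rule ccontr)
    fix x y assume xy: "x \<in> D" "y \<in> D" "e \<bullet> x = e \<bullet> y" "x \<noteq> y"
    then have "x - y \<in> V" by (auto simp: V_def)
    then show False using e xy by (auto simp: inner_diff_right)
  qed
  moreover have "inj_on (\<lambda>x. e \<bullet> inversion b x) (D - {b})" if b: "b \<in> D" for b
  proof (rule inj_onI, rule ccontr)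
    fix x y assume xy: "x \<in> D - {b}" "y \<in> D - {b}" "e \<bullet> inversion b x = e \<bullet> inversion b y" "x \<noteq> y"
    then have "inversion b x \<noteq> inversion b y" using inversion_inj[of b] by (auto simp: inj_on_def)
    moreover have "inversion b x - inversion b y \<in> (\<lambda>(b,x,y). inversion b x - inversion b y) ` (D \<times> D \<times> D)"
      using xy b by (intro image_eqI[where x = "(b,x,y)"]) auto
    ultimately have "inversion b x - inversion b y \<in> V" by (simp add: V_def)
    then show False using e xy by (auto simp: inner_diff_right)
  qed
  ultimately show ?thesis by blast
qed

text \<open>Taking \<open>X b x = e \<bullet> inversion b x\<close> ties the coordinates at all dots to the single order by
  \<open>e \<bullet> x\<close>, because \<open>inversion b x\<close> is a positive multiple of \<open>x - b\<close>. The hypothesis \<open>coords\<close> says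
  that the inverted dots lie in a plane on which \<open>e\<close> and some further \<open>f\<close> are affine
  coordinates; it may use that \<open>e\<close> is injective on them.\<close>

lemma card_separating_by_inversion:
  fixes D M :: "'a::euclidean_space set"
  assumes fin: "finite D" and n: "card D = k + l + 3" and DM: "D \<subseteq> M"
    and circle: "\<And>T. T \<subseteq> D \<Longrightarrow> card T = 3 \<Longrightarrow> \<exists>!C. C \<in> \<C> \<and> T \<subseteq> C"
    and no4: "no_four_cocircular \<C> D"
    and coords: "\<And>e b. \<lbrakk>b \<in> D; inj_on (\<lambda>x. e \<bullet> inversion b x) (D - {b})\<rbrakk> \<Longrightarrow>
      \<exists>f. \<forall>a. \<exists>\<alpha> \<beta> \<delta>. \<forall>z\<in>D - {b}. a \<bullet> inversion b z =
        \<alpha> * (e \<bullet> inversion b z) + \<beta> * (f \<bullet> inversion b z) + \<delta>"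
    and sides: "\<And>C b u w. \<lbrakk>C \<in> \<C>; {b,u,w} \<subseteq> C \<inter> D; b \<noteq> u; b \<noteq> w; u \<noteq> w\<rbrakk> \<Longrightarrow>
      \<exists>U V a d. components (M - C) = {U, V} \<and> U \<noteq> V \<and>
        a \<bullet> inversion b u + d = 0 \<and> a \<bullet> inversion b w + d = 0 \<and>
        (\<forall>z\<in>D - {b}. (z \<in> U \<longleftrightarrow> a \<bullet> inversion b z + d > 0) \<and>
                     (z \<in> V \<longleftrightarrow> a \<bullet> inversion b z + d < 0))"
  shows "card {C\<in>\<C>. separates_dots M D C k l} =
    (if k \<noteq> l then 2 * (k + 1) * (l + 1) else (k + 1)^2)"
proof -
  obtain e where e1: "inj_on (\<lambda>x. e \<bullet> x) D"
    and e2: "\<And>b. b \<in> D \<Longrightarrow> inj_on (\<lambda>x. e \<bullet> inversion b x) (D - {b})"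
    using generic_inversion_direction[OF fin] by blast
  have "\<forall>b\<in>D. \<exists>f. \<forall>a. \<exists>\<alpha> \<beta> \<delta>. \<forall>z\<in>D - {b}. a \<bullet> inversion b z =
        \<alpha> * (e \<bullet> inversion b z) + \<beta> * (f \<bullet> inversion b z) + \<delta>"
    using coords e2 by blast
  then obtain f where f: "\<And>b a. b \<in> D \<Longrightarrow> \<exists>\<alpha> \<beta> \<delta>. \<forall>z\<in>D - {b}. a \<bullet> inversion b z =
        \<alpha> * (e \<bullet> inversion b z) + \<beta> * (f b \<bullet> inversion b z) + \<delta>"
    by metis
  show ?thesis
  proof (rule card_separating_family[where X = "\<lambda>b x. e \<bullet> inversion b x" and
        Y = "\<lambda>b x. f b \<bullet> inversion b x" and \<phi> = "\<lambda>x. e \<bullet> x"])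
    fix b x assume "b \<in> D" "x \<in> D" "x \<noteq> b"
    then show "sgn (e \<bullet> inversion b x) = sgn (e \<bullet> x - e \<bullet> b)"
      by (simp add: inner_inversion sgn_divide inner_diff_right)
  next
    fix C b u w assume C: "C \<in> \<C>" "{b,u,w} \<subseteq> C \<inter> D" "b \<noteq> u" "b \<noteq> w" "u \<noteq> w"
    obtain U V a d where uv: "components (M - C) = {U, V}" "U \<noteq> V"
      and z: "a \<bullet> inversion b u + d = 0" "a \<bullet> inversion b w + d = 0"
      and s: "\<forall>z\<in>D - {b}. (z \<in> U \<longleftrightarrow> a \<bullet> inversion b z + d > 0) \<and>
                     (z \<in> V \<longleftrightarrow> a \<bullet> inversion b z + d < 0)"
      using sides[OF C] by metis
    obtain \<alpha> \<beta> \<delta> where c: "\<forall>z\<in>D - {b}. a \<bullet> inversion b z =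
        \<alpha> * (e \<bullet> inversion b z) + \<beta> * (f b \<bullet> inversion b z) + \<delta>"
      using f[of b a] C(2) by auto
    have c': "\<alpha> * (e \<bullet> inversion b z) + \<beta> * (f b \<bullet> inversion b z) + (\<delta> + d) = a \<bullet> inversion b z + d"
      if "z \<in> D - {b}" for z
      using c that by simp
    show "\<exists>U V \<alpha> \<beta> \<delta>. components (M - C) = {U, V} \<and> U \<noteq> V \<and>
        \<alpha> * (e \<bullet> inversion b u) + \<beta> * (f b \<bullet> inversion b u) + \<delta> = 0 \<and>
        \<alpha> * (e \<bullet> inversion b w) + \<beta> * (f b \<bullet> inversion b w) + \<delta> = 0 \<and>
        (\<forall>z\<in>D - {b}. (z \<in> U \<longleftrightarrow> \<alpha> * (e \<bullet> inversion b z) + \<beta> * (f b \<bullet> inversion b z) + \<delta> > 0) \<and>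
                     (z \<in> V \<longleftrightarrow> \<alpha> * (e \<bullet> inversion b z) + \<beta> * (f b \<bullet> inversion b z) + \<delta> < 0))"
    proof (intro exI conjI)
      show "\<alpha> * (e \<bullet> inversion b u) + \<beta> * (f b \<bullet> inversion b u) + (\<delta> + d) = 0"
        "\<alpha> * (e \<bullet> inversion b w) + \<beta> * (f b \<bullet> inversion b w) + (\<delta> + d) = 0"
        using c'[of u] c'[of w] C z by auto
      show "\<forall>z\<in>D - {b}. (z \<in> U \<longleftrightarrow> \<alpha> * (e \<bullet> inversion b z) + \<beta> * (f b \<bullet> inversion b z) + (\<delta> + d) > 0) \<and>
                     (z \<in> V \<longleftrightarrow> \<alpha> * (e \<bullet> inversion b z) + \<beta> * (f b \<bullet> inversion b z) + (\<delta> + d) < 0)"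
      proof
        fix z assume z: "z \<in> D - {b}"
        show "(z \<in> U \<longleftrightarrow> \<alpha> * (e \<bullet> inversion b z) + \<beta> * (f b \<bullet> inversion b z) + (\<delta> + d) > 0) \<and>
              (z \<in> V \<longleftrightarrow> \<alpha> * (e \<bullet> inversion b z) + \<beta> * (f b \<bullet> inversion b z) + (\<delta> + d) < 0)"
          unfolding c'[OF z] using s z by blast
      qed
    qed (use uv in auto)
  qed (use fin n DM circle no4 e1 e2 in blast)+
qed

section \<open>The two sides of a circle\<close>

text \<open>By the intermediate value theorem a connected set on which \<open>g\<close> has no zero lies on one side.\<close>

lemma components_by_sign:
  fixes g :: "'a::topological_space \<Rightarrow> real"
  assumes cont: "continuous_on M g"
    and conn: "connected {x\<in>M. g x > 0}" "connected {x\<in>M. g x < 0}"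
    and ne: "{x\<in>M. g x > 0} \<noteq> {}" "{x\<in>M. g x < 0} \<noteq> {}"
    and C: "M - C = {x\<in>M. g x \<noteq> 0}"
  shows "components (M - C) = {{x\<in>M. g x > 0}, {x\<in>M. g x < 0}}"
    and "{x\<in>M. g x > 0} \<noteq> {x\<in>M. g x < 0}"
proof -
  let ?P = "{x\<in>M. g x > 0}" and ?N = "{x\<in>M. g x < 0}"
  have S: "M - C = ?P \<union> ?N" unfolding C by (auto simp: neq_iff)
  have pure: "K \<subseteq> ?P \<or> K \<subseteq> ?N" if "K \<in> components (M - C)" for K
  proof (rule ccontr)
    assume "\<not> (K \<subseteq> ?P \<or> K \<subseteq> ?N)"
    moreover have KS: "K \<subseteq> ?P \<union> ?N" using in_components_subset[OF that] S by simp
    ultimately obtain x y where xy: "x \<in> K" "y \<in> K" "g x < 0" "g y > 0" by blast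
    have "continuous_on K g" using KS by (intro continuous_on_subset[OF cont]) auto
    then have "connected (g ` K)"
      using in_components_connected[OF that] by (rule connected_continuous_image)
    then have "0 \<in> g ` K"
      using xy connectedD_interval[of "g ` K" "g x" "g y" 0] by auto
    then show False using KS by auto
  qed
  have S': "?P \<subseteq> M - C" "?N \<subseteq> M - C" "M - C \<noteq> {}" using S ne by simp_all
  obtain KP where KP: "KP \<in> components (M - C)" "?P \<subseteq> KP"
    using exists_component_superset[OF S'(1,3) conn(1)] by metis
  obtain KN where KN: "KN \<in> components (M - C)" "?N \<subseteq> KN"
    using exists_component_superset[OF S'(2,3) conn(2)] by metis
  have disj: "?P \<inter> ?N = {}" by auto
  have whole: "K = A" if "K \<subseteq> A \<or> K \<subseteq> B" "A \<subseteq> K" "A \<inter> B = {}" "A \<noteq> {}" for K A B :: "'a set"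
    using that by blast
  have P: "?P \<in> components (M - C)"
    using KP(1) whole[OF pure[OF KP(1)] KP(2) disj ne(1)] by simp
  have KN': "KN \<subseteq> ?N \<or> KN \<subseteq> ?P" "?N \<inter> ?P = {}"
    using pure[OF KN(1)] disj by (simp_all only: disj_commute Int_commute)
  have N: "?N \<in> components (M - C)"
    using KN(1) unfolding whole[OF KN'(1) KN(2) KN'(2) ne(2)] .
  have "L = ?P \<or> L = ?N" if L: "L \<in> components (M - C)" for L
  proof -
    obtain x where x: "x \<in> L" using in_components_nonempty[OF L] by blast
    then have "x \<in> ?P \<or> x \<in> ?N" using in_components_subset[OF L] S by blast
    then show ?thesis using components_eq[OF L P] components_eq[OF L N] x by blast
  qed
  then show "components (M - C) = {?P, ?N}" using P N by blast
  show "?P \<noteq> ?N" using ne disj by blast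
qed

section \<open>Circles in the plane\<close>

text \<open>The expansion of \<open>a\<close> in the orthogonal basis formed by \<open>e\<close> and \<open>e\<close> turned by a right angle.\<close>

lemma plane_coordinates:
  fixes e a y :: "real^2"
  defines "f \<equiv> vector [- e$2, e$1]"
  shows "(e \<bullet> e) * (a \<bullet> y) = (a \<bullet> e) * (e \<bullet> y) + (a \<bullet> f) * (f \<bullet> y)"
  unfolding f_def inner_vec_def sum_2 by (simp add: algebra_simps)

lemma inner_real2: "(x::real^2) \<bullet> y = x$1 * y$1 + x$2 * y$2"
  by (simp add: inner_vec_def sum_2)

lemma not_collinear_det2:
  fixes b u w :: "real^2"
  assumes "\<not> collinear {b,u,w}"
  shows "(u-b)$1 * (w-b)$2 - (u-b)$2 * (w-b)$1 \<noteq> 0"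
proof
  assume 0: "(u-b)$1 * (w-b)$2 - (u-b)$2 * (w-b)$1 = 0"
  define x y where "x = u - b" and "y = w - b"
  have xy: "x$1 * y$2 = x$2 * y$1" using 0 by (simp add: x_def y_def)
  have "collinear {0,x,y}"
  proof (cases "x = 0")
    case False
    then have ne: "x$1 \<noteq> 0 \<or> x$2 \<noteq> 0" by (auto simp: vec_eq_iff forall_2)
    have "\<exists>c. y = c *\<^sub>R x"
    proof (cases "x$1 = 0")
      case True
      then show ?thesis using ne xy
        by (intro exI[of _ "y$2 / x$2"]) (auto simp: vec_eq_iff forall_2)
    next
      case False
      then show ?thesis using xy
        by (intro exI[of _ "y$1 / x$1"]) (auto simp: vec_eq_iff forall_2 field_simps)
    qed
    then show ?thesis by (simp add: collinear_lemma)
  qed simp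
  then have "collinear {u,b,w}" by (subst collinear_3) (simp_all add: x_def y_def)
  then show False using assms by (simp add: insert_commute)
qed

text \<open>Divided by the square of \<open>norm (x - b)\<close>, these conditions become affine in \<open>inversion b x\<close>: this is
  how spheres through \<open>b\<close> turn into hyperplanes.\<close>

lemma on_sphere_iff:
  fixes c b x :: "'a::real_inner"
  assumes "dist c b = r"
  shows "dist c x = r \<longleftrightarrow> 2 * ((x - b) \<bullet> (c - b)) = (x - b) \<bullet> (x - b)"
    and "dist c x < r \<longleftrightarrow> (x - b) \<bullet> (x - b) < 2 * ((x - b) \<bullet> (c - b))"
proof -
  have "(dist c x)\<^sup>2 = (x - b) \<bullet> (x - b) - 2 * ((x - b) \<bullet> (c - b)) + (dist c b)\<^sup>2"
    by (simp add: dist_norm power2_norm_eq_inner algebra_simps inner_commute)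
  moreover have "dist c x = r \<longleftrightarrow> (dist c x)\<^sup>2 = r\<^sup>2" "dist c x < r \<longleftrightarrow> (dist c x)\<^sup>2 < r\<^sup>2"
    using assms by (auto simp: power2_eq_iff_nonneg intro: power_less_imp_less_base power_strict_mono)
  ultimately show "dist c x = r \<longleftrightarrow> 2 * ((x - b) \<bullet> (c - b)) = (x - b) \<bullet> (x - b)"
    "dist c x < r \<longleftrightarrow> (x - b) \<bullet> (x - b) < 2 * ((x - b) \<bullet> (c - b))"
    using assms by auto
qed

text \<open>By \<open>on_sphere_iff\<close> the centre relative to \<open>b\<close> solves a linear system of two equations whose
  determinant does not vanish; \<open>\<gamma>\<close> is the solution according to Cramer's rule.\<close>

lemma circumcircle_exists_unique:
  fixes b u w :: "real^2"
  assumes "\<not> collinear {b,u,w}"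
  shows "\<exists>!C. C \<in> plane_circles \<and> {b,u,w} \<subseteq> C"
proof -
  define x y where "x = u - b" and "y = w - b"
  define \<Delta> where "\<Delta> = x$1 * y$2 - x$2 * y$1"
  have \<Delta>: "\<Delta> \<noteq> 0" using not_collinear_det2[OF assms] by (simp add: \<Delta>_def x_def y_def)
  have x0: "x \<noteq> 0" using \<Delta> by (auto simp: \<Delta>_def)
  define \<gamma> :: "real^2" where
    "\<gamma> = vector [((x \<bullet> x) * y$2 - (y \<bullet> y) * x$2) / (2*\<Delta>), (x$1 * (y \<bullet> y) - y$1 * (x \<bullet> x)) / (2*\<Delta>)]"
  have "2 * \<Delta> * \<gamma>$1 = (x \<bullet> x) * y$2 - (y \<bullet> y) * x$2"
    "2 * \<Delta> * \<gamma>$2 = x$1 * (y \<bullet> y) - y$1 * (x \<bullet> x)"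
    using \<Delta> by (simp_all add: \<gamma>_def)
  then have "\<Delta> * (2 * (x$1 * \<gamma>$1 + x$2 * \<gamma>$2)) = \<Delta> * (x \<bullet> x)"
    "\<Delta> * (2 * (y$1 * \<gamma>$1 + y$2 * \<gamma>$2)) = \<Delta> * (y \<bullet> y)"
    unfolding \<Delta>_def by algebra+
  then have \<gamma>: "2 * (x \<bullet> \<gamma>) = x \<bullet> x" "2 * (y \<bullet> \<gamma>) = y \<bullet> y"
    using \<Delta> by (simp_all add: inner_real2[of _ \<gamma>])
  have \<gamma>0: "\<gamma> \<noteq> 0" using \<gamma>(1) x0 by auto
  define C where "C = sphere (b + \<gamma>) (norm \<gamma>)"
  have d: "dist (b + \<gamma>) b = norm \<gamma>" by (simp add: dist_norm)
  have "C \<in> plane_circles" unfolding C_def plane_circles_def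
    using \<gamma>0 by (intro CollectI exI[of _ "b + \<gamma>"] exI[of _ "norm \<gamma>"]) simp
  moreover have "{b,u,w} \<subseteq> C"
    using on_sphere_iff(1)[OF d, of u] on_sphere_iff(1)[OF d, of w] \<gamma> d
    by (simp add: C_def x_def y_def)
  moreover have "C' = C" if in_circles: "C' \<in> plane_circles" and through: "{b,u,w} \<subseteq> C'" for C'
  proof -
    obtain c r where C': "C' = sphere c r" using in_circles by (auto simp: plane_circles_def)
    have db: "dist c b = r" using through C' by simp
    have "2 * (x \<bullet> (c - b)) = x \<bullet> x" "2 * (y \<bullet> (c - b)) = y \<bullet> y"
      using on_sphere_iff(1)[OF db, of u] on_sphere_iff(1)[OF db, of w] through C'
      by (simp_all add: x_def y_def)
    then have eq: "x \<bullet> (c - b) = x \<bullet> \<gamma>" "y \<bullet> (c - b) = y \<bullet> \<gamma>" using \<gamma> by linarith+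
    define v where "v = c - b - \<gamma>"
    have "x \<bullet> v = 0" "y \<bullet> v = 0" using eq by (simp_all add: v_def inner_diff_right)
    then have "x$1 * v$1 + x$2 * v$2 = 0" "y$1 * v$1 + y$2 * v$2 = 0" by (simp_all add: inner_real2)
    then have "\<Delta> * v$1 = 0" "\<Delta> * v$2 = 0" unfolding \<Delta>_def by algebra+
    then have "v = 0" using \<Delta> by (simp add: vec_eq_iff forall_2)
    then have "c = b + \<gamma>" by (simp add: v_def algebra_simps)
    then show ?thesis using db d C' by (simp add: C_def)
  qed
  ultimately show ?thesis by metis
qed

lemma components_off_plane_circle:
  fixes c :: "real^2"
  assumes "r > 0"
  shows "components (UNIV - sphere c r) = {ball c r, - cball c r}" and "ball c r \<noteq> - cball c r"
proof -
  have e: "{x \<in> UNIV. 0 < r - dist c x} = ball c r" "{x \<in> UNIV. r - dist c x < 0} = - cball c r"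
    by auto
  have "connected (- cball c r)"
    by (rule connected_complement_bounded_convex) auto
  moreover have "- cball c r \<noteq> {}"
    using bounded_cball[of c r] not_bounded_UNIV by (metis Compl_empty_eq double_complement)
  moreover have "continuous_on UNIV (\<lambda>x. r - dist c x)" by (intro continuous_intros)
  moreover have "ball c r \<noteq> {}" using assms by simp
  moreover have "UNIV - sphere c r = {x \<in> UNIV. r - dist c x \<noteq> 0}" by auto
  ultimately show "components (UNIV - sphere c r) = {ball c r, - cball c r}" "ball c r \<noteq> - cball c r"
    using components_by_sign[of UNIV "\<lambda>x. r - dist c x" "sphere c r"] unfolding e by auto
qed

lemma card_separating_plane_circles:
  fixes D :: "(real^2) set"
  assumes fin: "finite D" and n: "card D = k + l + 3" and gp: "plane_general_position D"
  shows "card {C \<in> plane_circles. separates_dots UNIV D C k l} =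
    (if k \<noteq> l then 2 * (k + 1) * (l + 1) else (k + 1)^2)"
proof (rule card_separating_by_inversion[OF fin n])
  fix T assume T: "T \<subseteq> D" "card T = 3"
  then obtain b u w where T3: "T = {b,u,w}" by (auto simp: card_3_iff)
  have "\<not> collinear T" using gp T unfolding plane_general_position_def by blast
  then show "\<exists>!C. C \<in> plane_circles \<and> T \<subseteq> C"
    unfolding T3 by (rule circumcircle_exists_unique)
next
  fix e b assume b: "b \<in> D" and inj: "inj_on (\<lambda>x. e \<bullet> inversion b x) (D - {b})"
  \<comment> \<open>A vanishing \<open>e\<close> could not separate the at least two dots other than \<open>b\<close>.\<close>
  have e: "e \<bullet> e \<noteq> 0"
  proof
    assume "e \<bullet> e = 0"
    then have "card (D - {b}) \<le> 1"
      using inj fin by (intro card_le_Suc0_iff_eq[THEN iffD2, unfolded One_nat_def[symmetric]]) (auto simp: inj_on_def)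
    then show False using b n fin by simp
  qed
  define f :: "real^2" where "f = vector [- e$2, e$1]"
  have "a \<bullet> y = ((a \<bullet> e) / (e \<bullet> e)) * (e \<bullet> y) + ((a \<bullet> f) / (e \<bullet> e)) * (f \<bullet> y) + 0" for a y
    using plane_coordinates[of e a y] e by (simp add: f_def field_simps)
  then show "\<exists>f. \<forall>a. \<exists>\<alpha> \<beta> \<delta>. \<forall>z\<in>D - {b}. a \<bullet> inversion b z =
        \<alpha> * (e \<bullet> inversion b z) + \<beta> * (f \<bullet> inversion b z) + \<delta>"
    by blast
next
  fix C b u w
  assume C: "C \<in> plane_circles" and on: "{b,u,w} \<subseteq> C \<inter> D" and ne: "b \<noteq> u" "b \<noteq> w"
  obtain c r where cr: "C = sphere c r" "r > 0" using C unfolding plane_circles_def by blast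
  have db: "dist c b = r" using on cr by simp
  let ?a = "2 *\<^sub>R (c - b)"
  have val: "?a \<bullet> inversion b z + -1 = (2 * ((z - b) \<bullet> (c - b)) - (z - b) \<bullet> (z - b)) / (norm (z - b))\<^sup>2"
    if "z \<noteq> b" for z
    using that by (simp add: inner_inversion power2_norm_eq_inner inner_commute[of "c - b"] diff_divide_distrib)
  have zero: "?a \<bullet> inversion b z + -1 = 0 \<longleftrightarrow> dist c z = r" if "z \<noteq> b" for z
    unfolding val[OF that] on_sphere_iff(1)[OF db] using that by simp
  have pos: "?a \<bullet> inversion b z + -1 > 0 \<longleftrightarrow> dist c z < r" if "z \<noteq> b" for z
    unfolding val[OF that] on_sphere_iff(2)[OF db] using that by (simp add: zero_less_divide_iff)
  have neg: "?a \<bullet> inversion b z + -1 < 0 \<longleftrightarrow> dist c z > r" if "z \<noteq> b" for z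
    using zero[OF that] pos[OF that] by linarith
  show "\<exists>U V a d. components (UNIV - C) = {U, V} \<and> U \<noteq> V \<and>
      a \<bullet> inversion b u + d = 0 \<and> a \<bullet> inversion b w + d = 0 \<and>
      (\<forall>z\<in>D - {b}. (z \<in> U \<longleftrightarrow> a \<bullet> inversion b z + d > 0) \<and> (z \<in> V \<longleftrightarrow> a \<bullet> inversion b z + d < 0))"
  proof (intro exI conjI ballI)
    show "components (UNIV - C) = {ball c r, - cball c r}" "ball c r \<noteq> - cball c r"
      using components_off_plane_circle[OF cr(2), of c] cr(1) by simp_all
    show "?a \<bullet> inversion b u + -1 = 0" "?a \<bullet> inversion b w + -1 = 0"
      using zero ne on cr(1) by (simp_all del: inner_scaleR_left)
    fix z assume "z \<in> D - {b}"
    then have "z \<noteq> b" by simp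
    then show "z \<in> ball c r \<longleftrightarrow> ?a \<bullet> inversion b z + -1 > 0" "z \<in> - cball c r \<longleftrightarrow> ?a \<bullet> inversion b z + -1 < 0"
      unfolding pos[OF \<open>z \<noteq> b\<close>] neg[OF \<open>z \<noteq> b\<close>] by auto
  qed
qed (use gp in \<open>simp_all add: plane_general_position_def\<close>)

section \<open>Circles on the sphere\<close>

unbundle cross3_syntax

text \<open>The cap is the image of an open half space under radial projection from the point \<open>q\<close> inside the
  sphere: the ray from \<open>q\<close> in the direction \<open>y\<close> meets the sphere in \<open>q + s y *\<^sub>R y\<close>, where
  \<open>s y\<close> is the positive root of a quadratic equation and depends continuously on \<open>y\<close>.\<close>

lemma sphere_cap_connected:
  fixes a c q :: "'a::real_inner"
  assumes q: "dist c q < r" and a: "a \<noteq> 0"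
  shows "connected {x \<in> sphere c r. a \<bullet> x > a \<bullet> q}" "{x \<in> sphere c r. a \<bullet> x > a \<bullet> q} \<noteq> {}"
proof -
  define p where "p = q - c"
  define \<rho> where "\<rho> = r\<^sup>2 - p \<bullet> p"
  have r: "r > 0" using q by (metis dist_not_less_zero not_less_iff_gr_or_eq order_less_trans)
  have "(norm p)\<^sup>2 < r\<^sup>2" using q r by (intro power_strict_mono) (auto simp: p_def dist_norm norm_minus_commute)
  then have \<rho>: "\<rho> > 0" by (simp add: \<rho>_def power2_norm_eq_inner)
  define s where "s y = (sqrt ((p \<bullet> y)\<^sup>2 + (y \<bullet> y) * \<rho>) - p \<bullet> y) / (y \<bullet> y)" for y
  let ?H = "{y. a \<bullet> y > 0}"
  have y0: "y \<bullet> y > 0" if "y \<in> ?H" for y using that by auto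
  have s_pos: "s y > 0" if "y \<in> ?H" for y
  proof -
    have "\<bar>p \<bullet> y\<bar> = sqrt ((p \<bullet> y)\<^sup>2)" by simp
    also have "\<dots> < sqrt ((p \<bullet> y)\<^sup>2 + (y \<bullet> y) * \<rho>)" using y0[OF that] \<rho> by (intro real_sqrt_less_mono) simp
    finally show ?thesis using y0[OF that] by (simp add: s_def)
  qed
  have s_root: "(y \<bullet> y) * (s y)\<^sup>2 + 2 * (p \<bullet> y) * s y = \<rho>" if "y \<in> ?H" for y
  proof -
    define R where "R = sqrt ((p \<bullet> y)\<^sup>2 + (y \<bullet> y) * \<rho>)"
    have "R\<^sup>2 = (p \<bullet> y)\<^sup>2 + (y \<bullet> y) * \<rho>" using y0[OF that] \<rho> by (simp add: R_def)
    moreover have "(y \<bullet> y) * s y = R - p \<bullet> y" using y0[OF that] by (simp add: s_def R_def)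
    ultimately have "(y \<bullet> y) * ((y \<bullet> y) * (s y)\<^sup>2 + 2 * (p \<bullet> y) * s y) = (y \<bullet> y) * \<rho>" by algebra
    then show ?thesis using y0[OF that] by simp
  qed
  have sph: "x \<in> sphere c r \<longleftrightarrow> (x - c) \<bullet> (x - c) = r\<^sup>2" for x
  proof -
    have "x \<in> sphere c r \<longleftrightarrow> (norm (x - c))\<^sup>2 = r\<^sup>2"
      using r by (auto simp: dist_norm norm_minus_commute power2_eq_iff_nonneg)
    then show ?thesis by (simp add: power2_norm_eq_inner)
  qed
  have sph': "(q + t *\<^sub>R y - c) \<bullet> (q + t *\<^sub>R y - c) = p \<bullet> p + ((y \<bullet> y) * t\<^sup>2 + 2 * (p \<bullet> y) * t)" for t y
  proof -
    have "q + t *\<^sub>R y - c = p + t *\<^sub>R y" by (simp add: p_def)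
    then show ?thesis
      by (simp only:) (simp add: inner_add_left inner_add_right power2_eq_square inner_commute algebra_simps)
  qed
  have img: "(\<lambda>y. q + s y *\<^sub>R y) ` ?H = {x \<in> sphere c r. a \<bullet> x > a \<bullet> q}"
  proof (intro equalityI subsetI)
    fix x assume "x \<in> (\<lambda>y. q + s y *\<^sub>R y) ` ?H"
    then obtain y where y: "y \<in> ?H" "x = q + s y *\<^sub>R y" by blast
    have "x \<in> sphere c r" unfolding sph y(2) sph' s_root[OF y(1)] by (simp add: \<rho>_def)
    moreover have "a \<bullet> x > a \<bullet> q" using y s_pos[OF y(1)] by (simp add: inner_add_right)
    ultimately show "x \<in> {x \<in> sphere c r. a \<bullet> x > a \<bullet> q}" by simp
  next
    fix x assume x: "x \<in> {x \<in> sphere c r. a \<bullet> x > a \<bullet> q}"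
    define y where "y = x - q"
    have y: "y \<in> ?H" using x by (simp add: y_def inner_diff_right)
    have "(x - c) \<bullet> (x - c) = r\<^sup>2" using x sph by blast
    then have root: "(y \<bullet> y) + 2 * (p \<bullet> y) = \<rho>" using sph'[of 1 y] by (simp add: y_def \<rho>_def)
    have "(p \<bullet> y)\<^sup>2 + (y \<bullet> y) * \<rho> = (p \<bullet> y + y \<bullet> y)\<^sup>2"
      unfolding root[symmetric] by (simp add: power2_eq_square algebra_simps)
    moreover have "p \<bullet> y + y \<bullet> y \<ge> 0" using root \<rho> y0[OF y] by linarith
    ultimately have "s y = 1" using y0[OF y] by (simp add: s_def)
    then have "x = q + s y *\<^sub>R y" by (simp add: y_def)
    then show "x \<in> (\<lambda>y. q + s y *\<^sub>R y) ` ?H" using y by blast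
  qed
  have "continuous_on ?H (\<lambda>y. q + s y *\<^sub>R y)"
    unfolding s_def by (intro continuous_intros) auto
  moreover have "connected ?H" by (intro convex_connected convex_halfspace_gt)
  ultimately have "connected ((\<lambda>y. q + s y *\<^sub>R y) ` ?H)"
    by (rule connected_continuous_image)
  then show "connected {x \<in> sphere c r. a \<bullet> x > a \<bullet> q}" unfolding img .
  have "a \<in> ?H" using a by simp
  then show "{x \<in> sphere c r. a \<bullet> x > a \<bullet> q} \<noteq> {}" unfolding img[symmetric] by blast
qed

text \<open>The midpoint of two points of the circle lies in its plane and, by the parallelogram law, inside
  the sphere, so that both sides are reached by radial projection from it.\<close>

lemma components_off_sphere_circle:
  fixes a c x y :: "'a::real_inner"
  assumes a: "a \<noteq> 0" and xy: "x \<noteq> y" "{x,y} \<subseteq> sphere c r \<inter> {z. a \<bullet> z = t}"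
  shows "components (sphere c r - sphere c r \<inter> {z. a \<bullet> z = t}) =
      {{z \<in> sphere c r. a \<bullet> z > t}, {z \<in> sphere c r. a \<bullet> z < t}}"
    and "{z \<in> sphere c r. a \<bullet> z > t} \<noteq> {z \<in> sphere c r. a \<bullet> z < t}"
proof -
  define q where "q = (1/2) *\<^sub>R (x + y)"
  have qt: "a \<bullet> q = t" using xy by (simp add: q_def inner_add_right)
  have nr: "dist c x = r" "dist c y = r" using xy by auto
  have "4 * (dist c q)\<^sup>2 + (dist x y)\<^sup>2 = 2 * (dist c x)\<^sup>2 + 2 * (dist c y)\<^sup>2"
    by (simp add: q_def dist_norm power2_norm_eq_inner algebra_simps inner_commute)
  moreover have "(dist x y)\<^sup>2 > 0" using xy by simp
  ultimately have "(dist c q)\<^sup>2 < r\<^sup>2" unfolding nr by linarith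
  then have q: "dist c q < r" using nr by (intro power_less_imp_less_base[of _ 2 r]) auto
  have e: "{z \<in> sphere c r. 0 < a \<bullet> z - t} = {z \<in> sphere c r. a \<bullet> z > t}"
    "{z \<in> sphere c r. a \<bullet> z - t < 0} = {z \<in> sphere c r. a \<bullet> z < t}" by auto
  note cap = sphere_cap_connected[OF q a] sphere_cap_connected[OF q, of "-a"]
  have cap1: "connected {z \<in> sphere c r. a \<bullet> z > t}" "{z \<in> sphere c r. a \<bullet> z > t} \<noteq> {}"
    using cap(1,2) unfolding qt by simp_all
  have cap2: "connected {z \<in> sphere c r. a \<bullet> z < t}" "{z \<in> sphere c r. a \<bullet> z < t} \<noteq> {}"
    using cap(3,4) a qt by simp_all
  have "continuous_on (sphere c r) (\<lambda>z. a \<bullet> z - t)" by (intro continuous_intros)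
  moreover have "sphere c r - sphere c r \<inter> {z. a \<bullet> z = t} = {z \<in> sphere c r. a \<bullet> z - t \<noteq> 0}" by auto
  ultimately show "components (sphere c r - sphere c r \<inter> {z. a \<bullet> z = t}) =
      {{z \<in> sphere c r. a \<bullet> z > t}, {z \<in> sphere c r. a \<bullet> z < t}}"
    "{z \<in> sphere c r. a \<bullet> z > t} \<noteq> {z \<in> sphere c r. a \<bullet> z < t}"
    using components_by_sign[of "sphere c r" "\<lambda>z. a \<bullet> z - t" "sphere c r \<inter> {z. a \<bullet> z = t}"] cap1 cap2
    unfolding e by blast+
qed

text \<open>A line meets a sphere in at most two points, so the three points span a plane, with normal
  vector \<open>a\<close>. A normal vector of any plane through them is orthogonal to both factors of the cross
  product \<open>a\<close> and hence parallel to it.\<close>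

lemma sphere_circle_exists_unique:
  fixes b u w :: "real^3"
  assumes S: "{b,u,w} \<subseteq> sphere c r" and ne: "b \<noteq> u" "b \<noteq> w" "u \<noteq> w"
  shows "\<exists>!C. C \<in> sphere_circles (sphere c r) \<and> {b,u,w} \<subseteq> C"
proof -
  define x y where "x = u - b" and "y = w - b"
  have xy: "x \<noteq> 0" "y \<noteq> 0" "x \<noteq> y" using ne by (auto simp: x_def y_def)
  have db: "dist c b = r" using S by simp
  have on: "2 * (x \<bullet> (c - b)) = x \<bullet> x" "2 * (y \<bullet> (c - b)) = y \<bullet> y"
    using on_sphere_iff(1)[OF db, of u] on_sphere_iff(1)[OF db, of w] S by (simp_all add: x_def y_def)
  define a where "a = x \<times> y"
  have a: "a \<noteq> 0"
  proof
    assume "a = 0"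
    then obtain t where t: "y = t *\<^sub>R x" using xy by (auto simp: a_def cross_eq_0 collinear_lemma)
    have "t * (x \<bullet> x) = t * t * (x \<bullet> x)" using on unfolding t by (simp add: algebra_simps)
    then have "t = 0 \<or> t = 1" using xy by simp
    then show False using t xy by auto
  qed
  define C where "C = sphere c r \<inter> {z. a \<bullet> z = a \<bullet> b}"
  have "a \<bullet> x = 0" "a \<bullet> y = 0" by (simp_all add: a_def dot_cross_self)
  then have au: "a \<bullet> u = a \<bullet> b" "a \<bullet> w = a \<bullet> b" by (simp_all add: x_def y_def inner_diff_right)
  have sub: "{b,u,w} \<subseteq> C" using S au by (auto simp: C_def)
  have "C \<in> sphere_circles (sphere c r)"
    unfolding sphere_circles_def
  proof (intro CollectI exI conjI)
    show "C = sphere c r \<inter> {z. a \<bullet> z = a \<bullet> b}" by (rule C_def)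
    show "{b, u} \<subseteq> sphere c r \<inter> {z. a \<bullet> z = a \<bullet> b}" using sub unfolding C_def by simp
  qed (use a ne in simp_all)
  moreover have "C' = C" if in_circles: "C' \<in> sphere_circles (sphere c r)" and through: "{b,u,w} \<subseteq> C'" for C'
  proof -
    obtain a' t where C': "C' = sphere c r \<inter> {z. a' \<bullet> z = t}" "a' \<noteq> 0"
      using in_circles unfolding sphere_circles_def by blast
    have t: "a' \<bullet> b = t" "a' \<bullet> x = 0" "a' \<bullet> y = 0"
      using through by (auto simp: C' x_def y_def inner_diff_right)
    have "a' \<times> a = 0" unfolding a_def Lagrange t by simp
    then obtain s where s: "a = s *\<^sub>R a'" using a C'(2) by (auto simp: cross_eq_0 collinear_lemma)
    then have "s \<noteq> 0" using a by auto
    then show ?thesis unfolding C_def C'(1) s t(1)[symmetric] by simp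
  qed
  ultimately show ?thesis using sub by metis
qed

text \<open>The expansion of \<open>a\<close> in the basis \<open>e\<close>, \<open>v\<close>, \<open>p\<close> by means of its dual basis, which consists of
  cross products.\<close>

lemma sphere_coordinates:
  fixes e v a y :: "real^3"
  defines "p \<equiv> e \<times> v"
  shows "(p \<bullet> p) * (a \<bullet> y) = (a \<bullet> (v \<times> p)) * (e \<bullet> y) + (a \<bullet> p) * (p \<bullet> y) + (a \<bullet> (p \<times> e)) * (v \<bullet> y)"
  unfolding p_def by (simp add: inner_vec_def sum_3 cross_components) algebra

lemma card_separating_sphere_circles:
  fixes D :: "(real^3) set"
  assumes fin: "finite D" and n: "card D = k + l + 3" and r: "r > 0" and DS: "D \<subseteq> sphere c r"
    and gp: "sphere_general_position (sphere c r) D"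
  shows "card {C \<in> sphere_circles (sphere c r). separates_dots (sphere c r) D C k l} =
    (if k \<noteq> l then 2 * (k + 1) * (l + 1) else (k + 1)^2)"
proof (rule card_separating_by_inversion[OF fin n DS])
  fix T assume T: "T \<subseteq> D" "card T = 3"
  then obtain b u w where T3: "T = {b,u,w}" "b \<noteq> u" "b \<noteq> w" "u \<noteq> w" by (auto simp: card_3_iff)
  have "{b,u,w} \<subseteq> sphere c r" using T T3 DS by blast
  then show "\<exists>!C. C \<in> sphere_circles (sphere c r) \<and> T \<subseteq> C"
    unfolding T3(1) by (rule sphere_circle_exists_unique) (use T3 in auto)
next
  fix e b assume b: "b \<in> D" and inj: "inj_on (\<lambda>x. e \<bullet> inversion b x) (D - {b})"
  define v where "v = b - c"
  define p where "p = e \<times> v"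
  have db: "dist c b = r" using b DS by auto
  have v0: "v \<noteq> 0" using db r by (auto simp: v_def)
  \<comment> \<open>Inversion at a point of the sphere maps the rest of the sphere into a plane orthogonal to the radius.\<close>
  have v: "v \<bullet> inversion b z = - 1/2" if "z \<in> D - {b}" for z
  proof -
    have "dist c z = r" using that DS by auto
    then have "2 * ((z - b) \<bullet> (c - b)) = (z - b) \<bullet> (z - b)"
      using on_sphere_iff(1)[OF db] by blast
    then have "2 * (v \<bullet> (z - b)) = - ((norm (z - b))\<^sup>2)"
      by (simp add: v_def power2_norm_eq_inner inner_diff_left inner_diff_right inner_commute)
    then show ?thesis using that by (simp add: inner_inversion field_simps)
  qed
  \<comment> \<open>If \<open>e\<close> were parallel to the radius \<open>v\<close>, it would be constant on the plane of the inverted dots.\<close>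
  have "p \<noteq> 0"
  proof
    assume "p = 0"
    then have "v \<times> e = 0" unfolding p_def by (subst cross_skew) simp
    then obtain t where "e = t *\<^sub>R v" using v0 by (auto simp: cross_eq_0 collinear_lemma)
    then have "card (D - {b}) \<le> 1"
      using inj fin v by (intro card_le_Suc0_iff_eq[THEN iffD2, unfolded One_nat_def[symmetric]]) (auto simp: inj_on_def)
    then show False using b n fin by simp
  qed
  then have p: "p \<bullet> p \<noteq> 0" by simp
  have "a \<bullet> inversion b z = ((a \<bullet> (v \<times> p)) / (p \<bullet> p)) * (e \<bullet> inversion b z)
      + ((a \<bullet> p) / (p \<bullet> p)) * (p \<bullet> inversion b z) + - (a \<bullet> (p \<times> e)) / (2 * (p \<bullet> p))"
    if "z \<in> D - {b}" for a z
  proof -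
    have "(p \<bullet> p) * (a \<bullet> inversion b z) = (a \<bullet> (v \<times> p)) * (e \<bullet> inversion b z)
        + (a \<bullet> p) * (p \<bullet> inversion b z) + (a \<bullet> (p \<times> e)) * (- 1/2)"
      using sphere_coordinates[of e v a "inversion b z"] unfolding p_def[symmetric] v[OF that] .
    then have "a \<bullet> inversion b z = ((a \<bullet> (v \<times> p)) * (e \<bullet> inversion b z)
        + (a \<bullet> p) * (p \<bullet> inversion b z) + (a \<bullet> (p \<times> e)) * (- 1/2)) / (p \<bullet> p)"
      using p by (simp add: eq_divide_eq mult.commute)
    then show ?thesis by (simp add: add_divide_distrib diff_divide_distrib)
  qed
  then show "\<exists>f. \<forall>a. \<exists>\<alpha> \<beta> \<delta>. \<forall>z\<in>D - {b}. a \<bullet> inversion b z =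
        \<alpha> * (e \<bullet> inversion b z) + \<beta> * (f \<bullet> inversion b z) + \<delta>"
    by blast
next
  fix C b u w
  assume C: "C \<in> sphere_circles (sphere c r)" and on: "{b,u,w} \<subseteq> C \<inter> D" and ne: "b \<noteq> u" "b \<noteq> w"
  obtain a t where at: "C = sphere c r \<inter> {z. a \<bullet> z = t}" "a \<noteq> 0"
    using C unfolding sphere_circles_def by blast
  have val: "a \<bullet> inversion b z + 0 = (a \<bullet> z - t) / (norm (z - b))\<^sup>2" for z
    using on at(1) by (simp add: inner_inversion inner_diff_right)
  have bu: "{b,u} \<subseteq> sphere c r \<inter> {z. a \<bullet> z = t}" using on at(1) by auto
  show "\<exists>U V a d. components (sphere c r - C) = {U, V} \<and> U \<noteq> V \<and>
      a \<bullet> inversion b u + d = 0 \<and> a \<bullet> inversion b w + d = 0 \<and>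
      (\<forall>z\<in>D - {b}. (z \<in> U \<longleftrightarrow> a \<bullet> inversion b z + d > 0) \<and> (z \<in> V \<longleftrightarrow> a \<bullet> inversion b z + d < 0))"
  proof (intro exI conjI ballI)
    show "components (sphere c r - C) = {{z \<in> sphere c r. a \<bullet> z > t}, {z \<in> sphere c r. a \<bullet> z < t}}"
      "{z \<in> sphere c r. a \<bullet> z > t} \<noteq> {z \<in> sphere c r. a \<bullet> z < t}"
      using components_off_sphere_circle[OF at(2) ne(1) bu] unfolding at(1) by blast+
    show "a \<bullet> inversion b u + 0 = 0" "a \<bullet> inversion b w + 0 = 0"
      unfolding val using on at(1) by simp_all
    fix z assume z: "z \<in> D - {b}"
    then have "z \<in> sphere c r" using DS by blast
    then show "z \<in> {z \<in> sphere c r. a \<bullet> z > t} \<longleftrightarrow> a \<bullet> inversion b z + 0 > 0"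
      "z \<in> {z \<in> sphere c r. a \<bullet> z < t} \<longleftrightarrow> a \<bullet> inversion b z + 0 < 0"
      unfolding val using z by (simp_all add: zero_less_divide_iff divide_less_0_iff)
  qed
qed (use gp in \<open>simp add: sphere_general_position_def\<close>)

section \<open>The count in the plane and on the sphere\<close>

theorem theoremA:
  fixes n k l :: nat
  assumes "n \<ge> 3" and "k + l = n - 3"
  shows "(\<forall>D :: (real^2) set.
            finite D \<and> card D = n \<and> plane_general_position D \<longrightarrow>
            card {C \<in> plane_circles. separates_dots UNIV D C k l} =
              (if k \<noteq> l then 2 * (k + 1) * (l + 1) else (k + 1)^2)) \<and>
         (\<forall>(c :: real^3) (r :: real) D.
            r > 0 \<and> D \<subseteq> sphere c r \<and>
            finite D \<and> card D = n \<and> sphere_general_position (sphere c r) D \<longrightarrow>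
            card {C \<in> sphere_circles (sphere c r). separates_dots (sphere c r) D C k l} =
              (if k \<noteq> l then 2 * (k + 1) * (l + 1) else (k + 1)^2))"
proof -
  have n: "n = k + l + 3" using assms by simp
  show ?thesis using card_separating_plane_circles[of _ k l] card_separating_sphere_circles[of _ k l] n by blast
qed

end
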